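(* Let $A=[A_{ij}]$ be a $2\times 2$ block matrix, $A=\begin{bmatrix} A_{11} & A_{12} \\ A_{21} & A_{22} \end{bmatrix}$, with blocks $A_{ij}\in M_n(\mathbb{C})$. Then $$\omega_p^p(A)\le \frac{1}{2^{p-2}}\sum_{i,j=1}^{2}\omega_p^p(a_{ij})\qquad\text{for } 2\le p\le\infty,$$ and $$\omega_p^p(A)\le \sum_{i,j=1}^{2}\omega_p^p(a_{ij})\qquad\text{for } 1\le p\le 2,$$ where $$a_{ij}=\begin{cases} A_{ij}, & i=j, \\[4pt] 2^{-\frac{1}{p}}\begin{bmatrix} 0 & A_{ij} \\ A_{ji} & 0 \end{bmatrix}, & i\neq j.\end{cases}$$
   Context: $M_m(\mathbb{C})$ is the space of $m\times m$ complex matrices, $T^*$ is the conjugate transpose of $T$, and $\operatorname{Re}(T)=\frac12(T+T^* )$. $\|T\|_p$ is the Schatten $p$-norm: $\|T\|_p=(\operatorname{tr}((T^*T)^{p/2}))^{1/p}$ for $1\le p<\infty$, and $\|T\|_\infty$ is the operator norm. The Schatten $p$-generalized numerical radius of a square complex matrix $T$ is $\omega_p(T)=\sup_{\theta\in\mathbb{R}}\|\operatorname{Re}(e^{i\theta}T)\|_p$, and $\omega_p^p(T)$ denotes $(\omega_p(T))^p$.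
   Formalization: For p>2 the printed factor 1/2^(p-2) is false (A_11=X≠0, other blocks 0); it is replaced by 2^(p-2). At p=∞, where ω_p^p is undefined, the claim is read after p-th roots as ω_∞(A) ≤ 2 max ω_∞(a_ij). *)

theory Defs
  imports "HOL-Analysis.Analysis"
begin

definition conj_transpose :: "complex^'n^'m \<Rightarrow> complex^'m^'n" where
  "conj_transpose T = map_matrix cnj (transpose T)"

definition scale_mat :: "complex \<Rightarrow> complex^'n^'m \<Rightarrow> complex^'n^'m" where
  "scale_mat c T = map_matrix (\<lambda>z. c * z) T"

definition re_part :: "complex^'n^'n \<Rightarrow> complex^'n^'n" where
  "re_part T = scale_mat (1/2) (T + conj_transpose T)"

definition unitary_mat :: "complex^'n^'n \<Rightarrow> bool" where
  "unitary_mat U \<longleftrightarrow> conj_transpose U ** U = mat 1 \<and> U ** conj_transpose U = mat 1"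

definition diag_mat :: "('n \<Rightarrow> real) \<Rightarrow> complex^'n^'n" where
  "diag_mat d = (\<chi> i j. if i = j then complex_of_real (d i) else 0)"

(* The real power P^s of a positive semidefinite matrix P, by functional calculus: apply
   t \<mapsto> t^s to the eigenvalues in a unitary diagonalisation.  The result does not depend on the
   diagonalisation chosen.  For s > 0 the convention 0 powr s = 0 is the right one. *)
definition psd_powr :: "complex^'n^'n \<Rightarrow> real \<Rightarrow> complex^'n^'n" where
  "psd_powr P s = (THE Q. \<exists>U d. unitary_mat U \<and> (\<forall>i. 0 \<le> d i) \<and>
      P = U ** diag_mat d ** conj_transpose U \<and>
      Q = U ** diag_mat (\<lambda>i. d i powr s) ** conj_transpose U)"

(* Meaningful for 1 \<le> p \<le> \<infinity>; the trace below is a nonnegative real number. *)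
definition schatten_norm :: "ereal \<Rightarrow> complex^'n^'n \<Rightarrow> real" where
  "schatten_norm p T =
     (if p = \<infinity> then onorm (\<lambda>x. T *v x)
      else Re (trace (psd_powr (conj_transpose T ** T) (real_of_ereal p / 2)))
             powr (1 / real_of_ereal p))"

definition gen_num_radius :: "ereal \<Rightarrow> complex^'n^'n \<Rightarrow> real" where
  "gen_num_radius p T = (SUP \<theta>::real. schatten_norm p (re_part (scale_mat (exp (\<i> * of_real \<theta>)) T)))"

definition block_mat ::
  "complex^'n^'n \<Rightarrow> complex^'n^'n \<Rightarrow> complex^'n^'n \<Rightarrow> complex^'n^'n \<Rightarrow> complex^('n + 'n)^('n + 'n)" where
  "block_mat A B C D = (\<chi> i j. case (i, j) of
       (Inl k, Inl l) \<Rightarrow> A $ k $ l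
     | (Inl k, Inr l) \<Rightarrow> B $ k $ l
     | (Inr k, Inl l) \<Rightarrow> C $ k $ l
     | (Inr k, Inr l) \<Rightarrow> D $ k $ l)"

(* The generalized numerical radius of a_ij.  The diagonal a_ii is n x n and the off-diagonal a_ij is
   2n x 2n, so they have different types and only their radii can be collected in one family.
   For p = \<infinity> the factor 2 powr (-1/p) evaluates to 1, as it should. *)
definition entry_radius :: "ereal \<Rightarrow> (nat \<Rightarrow> nat \<Rightarrow> complex^'n^'n) \<Rightarrow> nat \<Rightarrow> nat \<Rightarrow> real" where
  "entry_radius p A i j =
     (if i = j then gen_num_radius p (A i j)
      else gen_num_radius p
             (scale_mat (of_real (2 powr (- 1 / real_of_ereal p))) (block_mat 0 (A i j) (A j i) 0)))"

(* Constant for p \<ge> 2.  The source prints the factor 1 / 2^(p-2) in front of the sum of the entries.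
   With that factor the inequality is false for every p > 2: for A_11 = X \<noteq> 0 and all other blocks 0
   it reads w_p^p(X) \<le> 2^(2-p) w_p^p(X).  The factor belongs to the left-hand side, i.e. the constant
   in front of the sum is 2^(p-2), as in the corresponding block inequality for Schatten norms.
   At p = \<infinity> the p-th power has no meaning; there the inequality is understood after taking p-th
   roots, where the constant 2^((p-2)/p) becomes 2 and the l^p sum of the four entries their maximum. *)

end

theory Submission
  imports Defs
begin

text \<open>For fixed \<open>\<theta>\<close> write \<open>Re (e\<^sup>i\<^sup>\<theta> M) = D + X\<close> with \<open>D\<close> block diagonal and \<open>X\<close> block off-diagonal, both
  Hermitian. Conjugation by \<open>diag(I, -I)\<close> turns \<open>D + X\<close> into \<open>D - X\<close>, so the two have the same Schatten norm
  and the Clarkson-McCarthy inequalities bound \<open>2 \<parallel>D + X\<parallel>\<^sub>p\<^sup>p\<close> by a multiple of \<open>\<parallel>D\<parallel>\<^sub>p\<^sup>p + \<parallel>X\<parallel>\<^sub>p\<^sup>p\<close>.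
  The factor \<open>2\<^sup>-\<^sup>1\<^sup>/\<^sup>p\<close> in the off-diagonal entries makes each of the two contribute half of \<open>\<parallel>X\<parallel>\<^sub>p\<^sup>p\<close>.

  For Hermitian \<open>A\<close> and \<open>B\<close>, Clarkson-McCarthy follows from \<open>(A + B)\<^sup>2 + (A - B)\<^sup>2 = 2 (A\<^sup>2 + B\<^sup>2)\<close> and two facts about
  positive semidefinite \<open>P\<close>, \<open>Q\<close> and convex \<open>f\<close> with \<open>f 0 = 0\<close>: \<open>tr f(P) + tr f(Q) \<le> tr f(P + Q)\<close> and
  \<open>2 tr f((P + Q)/2) \<le> tr f(P) + tr f(Q)\<close>. Both are Jensen inequalities for weights built from the overlaps
  of the eigenbases; they are used with \<open>f t = t\<^sup>p\<^sup>/\<^sup>2\<close> for \<open>p \<ge> 2\<close> and \<open>f t = - t\<^sup>p\<^sup>/\<^sup>2\<close> for \<open>p \<le> 2\<close>.\<close>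

section \<open>Adjoints, diagonal and unitary matrices, and the complex inner product\<close>

lemma conj_transpose_nth [simp]: "conj_transpose T $ i $ j = cnj (T $ j $ i)"
  by (simp add: conj_transpose_def map_matrix_def transpose_def)

lemma scale_mat_nth [simp]: "scale_mat c T $ i $ j = c * T $ i $ j"
  by (simp add: scale_mat_def map_matrix_def)

lemma diag_mat_nth: "diag_mat d $ i $ j = (if i = j then complex_of_real (d i) else 0)"
  by (simp add: diag_mat_def)

lemma conj_transpose_conj_transpose [simp]: "conj_transpose (conj_transpose T) = T"
  by (simp add: vec_eq_iff)

lemma conj_transpose_mult: "conj_transpose (A ** B) = conj_transpose B ** conj_transpose A"
  by (simp add: vec_eq_iff matrix_matrix_mult_def mult.commute)

lemma conj_transpose_diag_mat [simp]: "conj_transpose (diag_mat d) = diag_mat d"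
  by (auto simp: vec_eq_iff diag_mat_nth)

lemma diag_mat_mult: "diag_mat a ** diag_mat b = diag_mat (\<lambda>i. a i * b i)"
  by (simp add: vec_eq_iff matrix_matrix_mult_def diag_mat_nth if_distrib [of "\<lambda>x. x * _"] cong: if_cong)

lemma diag_mat_mult_nth: "(diag_mat d ** T) $ i $ j = complex_of_real (d i) * T $ i $ j"
  by (simp add: matrix_matrix_mult_def diag_mat_nth if_distrib [of "\<lambda>x. x * _"] cong: if_cong)

lemma mult_diag_mat_nth: "(T ** diag_mat d) $ i $ j = T $ i $ j * complex_of_real (d j)"
  by (simp add: matrix_matrix_mult_def diag_mat_nth if_distrib [of "\<lambda>x. _ * x"] cong: if_cong)

lemma unitary_matD:
  assumes "unitary_mat U"
  shows "conj_transpose U ** U = mat 1" "U ** conj_transpose U = mat 1"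
  using assms by (auto simp: unitary_mat_def)

lemma unitary_mat_conj_transpose: "unitary_mat U \<Longrightarrow> unitary_mat (conj_transpose U)"
  by (simp add: unitary_mat_def)

lemma unitary_mat_mult:
  assumes "unitary_mat U" "unitary_mat V"
  shows "unitary_mat (U ** V)"
  unfolding unitary_mat_def conj_transpose_mult
  by (metis assms matrix_mul_assoc matrix_mul_rid unitary_mat_def)

text \<open>Conjugate-linear in the first argument. The real-valued \<open>inner\<close> on
  \<open>complex^'n\<close> is only its real part and cannot express orthonormality over the complex
  numbers.\<close>

definition cinner_vec :: "complex^'n \<Rightarrow> complex^'n \<Rightarrow> complex" where
  "cinner_vec x y = (\<Sum>i\<in>UNIV. cnj (x $ i) * y $ i)"

lemma Re_cinner_vec: "Re (cinner_vec x y) = inner x y"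
  by (simp add: cinner_vec_def inner_vec_def inner_complex_def)

lemma cinner_vec_self: "cinner_vec x x = complex_of_real ((norm x)\<^sup>2)"
proof -
  have "cinner_vec x x = complex_of_real (\<Sum>i\<in>UNIV. (cmod (x $ i))\<^sup>2)"
    unfolding cinner_vec_def of_real_sum
    by (intro sum.cong refl) (metis complex_norm_square mult.commute)
  then show ?thesis
    by (simp add: norm_vec_def L2_set_def sum_nonneg)
qed

lemma cinner_vec_commute: "cinner_vec y x = cnj (cinner_vec x y)"
  by (simp add: cinner_vec_def mult.commute)

lemma cinner_vec_adjoint: "cinner_vec x (T *v y) = cinner_vec (conj_transpose T *v x) y"
proof -
  have "cinner_vec x (T *v y) = (\<Sum>i\<in>UNIV. \<Sum>j\<in>UNIV. cnj (x $ i) * T $ i $ j * y $ j)"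
    by (simp add: cinner_vec_def matrix_vector_mult_def sum_distrib_left mult.assoc)
  also have "\<dots> = (\<Sum>j\<in>UNIV. \<Sum>i\<in>UNIV. cnj (x $ i) * T $ i $ j * y $ j)"
    by (rule sum.swap)
  also have "\<dots> = cinner_vec (conj_transpose T *v x) y"
    by (simp add: cinner_vec_def matrix_vector_mult_def sum_distrib_left mult_ac)
  finally show ?thesis .
qed

lemma cinner_vec_scaleR_right: "cinner_vec x (r *\<^sub>R y) = complex_of_real r * cinner_vec x y"
  by (simp add: cinner_vec_def sum_distrib_left scaleR_conv_of_real[where 'a=complex] mult_ac)

lemma cinner_vec_add_right: "cinner_vec x (y + z) = cinner_vec x y + cinner_vec x z"
  by (simp add: cinner_vec_def algebra_simps sum.distrib)

lemma norm_matrix_vector_isometry: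
  assumes "conj_transpose U ** U = mat 1"
  shows "norm (U *v x) = norm x"
proof -
  have "cinner_vec (U *v x) (U *v x) = cinner_vec x x"
    by (simp add: cinner_vec_adjoint matrix_vector_mul_assoc assms)
  then have "(norm (U *v x))\<^sup>2 = (norm x)\<^sup>2"
    by (simp add: cinner_vec_self del: of_real_power)
  then show ?thesis by simp
qed

section \<open>Spectral theorem for Hermitian matrices\<close>

text \<open>The eigenvector is a maximizer of the Rayleigh quotient on the unit sphere of \<open>W\<close>.\<close>
lemma self_adjoint_eigenvector:
  fixes f :: "'a::euclidean_space \<Rightarrow> 'a"
  assumes f: "linear f" and sa: "\<And>x y. inner (f x) y = inner x (f y)"
    and W: "subspace W" "f ` W \<subseteq> W" and x0: "x0 \<in> W" "x0 \<noteq> 0"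
  obtains v l where "v \<in> W" "norm v = 1" "f v = l *\<^sub>R v"
proof -
  let ?K = "sphere 0 1 \<inter> W"
  have "compact ?K"
    by (simp add: W closed_subspace compact_Int_closed)
  moreover have "x0 /\<^sub>R norm x0 \<in> ?K"
    using x0 W by (simp add: subspace_scale)
  then have "?K \<noteq> {}" by blast
  moreover have "continuous_on ?K (\<lambda>x. inner x (f x))"
    by (intro continuous_intros linear_continuous_on) (simp add: f linear_conv_bounded_linear[symmetric])
  ultimately obtain v where v: "v \<in> ?K" and max: "\<And>x. x \<in> ?K \<Longrightarrow> inner x (f x) \<le> inner v (f v)"
    using continuous_attains_sup by metis
  define l where "l = inner v (f v)"
  have vv: "inner v v = 1" using v by (simp add: norm_eq_1)
  \<comment> \<open>\<open>g\<close> is the quadratic form of \<open>l - f\<close>: nonnegative on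
    \<open>W\<close> because \<open>l\<close> is the maximum, and 0 at \<open>v\<close>.\<close>
  define g where "g = (\<lambda>w. l * inner w w - inner w (f w))"
  have g: "0 \<le> g w" if "w \<in> W" for w
  proof (cases "w = 0")
    case False
    let ?u = "w /\<^sub>R norm w"
    have "?u \<in> ?K" using that False W by (simp add: subspace_scale)
    then have "inner ?u (f ?u) \<le> l" using max l_def by blast
    then have "inner w (f w) / (norm w)\<^sup>2 \<le> l"
      by (simp add: linear_scale[OF f] power2_eq_square field_simps)
    then show ?thesis using False
      by (simp add: g_def power2_norm_eq_inner divide_le_eq)
  qed (simp add: g_def linear_0[OF f])
  define r where "r = l *\<^sub>R v - f v"
  have r: "r \<in> W" unfolding r_def using W v by (intro subspace_diff subspace_scale) auto
  \<comment> \<open>Since \<open>r\<close> is \<open>(l - f) v\<close>, moving from \<open>v\<close>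
    against \<open>r\<close> changes \<open>g\<close> to first order by
    \<open>- 2 * t * inner r r\<close>. As \<open>g\<close> stays nonnegative, \<open>r\<close> must
    vanish.\<close>
  have exp: "g (v - t *\<^sub>R r) = - 2 * t * inner r r + t\<^sup>2 * g r" for t
  proof -
    have "inner v (f r) = inner r (f v)" by (metis sa inner_commute)
    then have "g (v - t *\<^sub>R r) = l * inner v v - inner v (f v) - 2 * t * (inner r (l *\<^sub>R v - f v)) + t\<^sup>2 * g r"
      by (simp add: g_def linear_diff[OF f] linear_scale[OF f] inner_commute algebra_simps power2_eq_square)
    then show ?thesis by (simp add: vv l_def[symmetric] r_def[symmetric])
  qed
  have "inner r r = 0"
  proof (rule ccontr)
    assume "inner r r \<noteq> 0"
    then have a: "inner r r > 0" by simp
    have b: "0 \<le> g r" using g r by blast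
    \<comment> \<open>This choice keeps \<open>t * g r\<close> at most \<open>inner r r\<close>,
      below the linear contribution \<open>2 * inner r r\<close>; the added 1 keeps the denominator
      positive when \<open>g r = 0\<close>.\<close>
    define t where "t = inner r r / (g r + 1)"
    have "v - t *\<^sub>R r \<in> W" using r v W by (intro subspace_diff subspace_scale) auto
    from g[OF this] have "0 \<le> t * (t * g r - 2 * inner r r)"
      unfolding exp by (simp add: power2_eq_square algebra_simps)
    moreover have "t > 0" using a b by (simp add: t_def)
    ultimately have "2 * inner r r \<le> t * g r" by (simp add: zero_le_mult_iff)
    moreover have "t * g r \<le> inner r r" using a b by (simp add: t_def divide_le_eq mult_left_mono)
    ultimately show False using a by linarith
  qed
  then have "f v = l *\<^sub>R v" by (simp add: r_def)
  with v show ?thesis using that by auto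
qed

text \<open>The conjugated vectors are rows of a square matrix that has a zero row for each index
  outside \<open>I\<close>. It is singular, and any nonzero kernel vector will do.\<close>

lemma exists_cinner_vec_orthogonal:
  fixes u :: "'n::finite \<Rightarrow> complex^'n"
  assumes "I \<noteq> UNIV"
  obtains x where "x \<noteq> 0" "\<And>i. i \<in> I \<Longrightarrow> cinner_vec (u i) x = 0"
proof -
  define R :: "complex^'n^'n" where "R = (\<chi> i j. if i \<in> I then cnj (u i $ j) else 0)"
  from assms obtain k where "k \<notin> I" by blast
  then have "row k R = 0" by (simp add: R_def row_def vec_eq_iff)
  then have "\<not> inj ((*v) R)"
    by (metis det_zero_row(2) invertible_det_nz invertible_left_inverse matrix_left_invertible_injective)
  then obtain x where "x \<noteq> 0" and x: "R *v x = 0"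
    by (metis matrix_left_invertible_injective matrix_left_invertible_ker)
  have "cinner_vec (u i) x = 0" if "i \<in> I" for i
    using arg_cong[OF x, of "\<lambda>y. y $ i"] that
    by (simp add: R_def matrix_vector_mult_def cinner_vec_def)
  with \<open>x \<noteq> 0\<close> show ?thesis using that by blast
qed

definition spectral_decomp :: "complex^'n^'n \<Rightarrow> ('n \<Rightarrow> real) \<Rightarrow> complex^'n^'n \<Rightarrow> bool" where
  "spectral_decomp U d T \<longleftrightarrow> unitary_mat U \<and> T = U ** diag_mat d ** conj_transpose U"

text \<open>Induction on the set of indices that already carry orthonormal eigenvectors: their
  orthogonal complement is nonzero and invariant under the Hermitian \<open>T\<close>, so it
  contains one more eigenvector.\<close>

theorem hermitian_spectral_decomp:
  fixes T :: "complex^'n^'n"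
  assumes herm: "conj_transpose T = T"
  obtains U d where "spectral_decomp U d T"
proof -
  have "\<exists>u d. \<forall>i\<in>I. T *v u i = complex_of_real (d i) *s u i \<and> (\<forall>j\<in>I. cinner_vec (u i) (u j) = (if i = j then 1 else 0))"
    if "finite I" for I :: "'n set"
    using that
  proof (induction I)
    case (insert k I)
    then obtain u d where u: "\<And>i. i \<in> I \<Longrightarrow> T *v u i = complex_of_real (d i) *s u i"
      "\<And>i j. i \<in> I \<Longrightarrow> j \<in> I \<Longrightarrow> cinner_vec (u i) (u j) = (if i = j then 1 else 0)"
      by metis
    define W where "W = {x. \<forall>i\<in>I. cinner_vec (u i) x = 0}"
    have "I \<noteq> UNIV" using insert by auto
    then obtain x where x: "x \<noteq> 0" "\<And>i. i \<in> I \<Longrightarrow> cinner_vec (u i) x = 0"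
      using exists_cinner_vec_orthogonal[of I u] by metis
    then have "x \<in> W" by (simp add: W_def)
    \<comment> \<open>\<open>W\<close> is used as a real subspace and \<open>T\<close> as a real
      linear map, symmetric for \<open>inner\<close>. The maximization argument then applies and
      yields a real eigenvalue.\<close>
    have "subspace W"
      by (auto simp: W_def subspace_def cinner_vec_add_right cinner_vec_scaleR_right)
         (simp add: cinner_vec_def)
    moreover have "T *v y \<in> W" if "y \<in> W" for y
    proof -
      have "cinner_vec (u i) (T *v y) = 0" if "i \<in> I" for i
      proof -
        have "cinner_vec (u i) (T *v y) = complex_of_real (d i) * cinner_vec (u i) y"
          using u(1)[OF that]
          by (simp add: cinner_vec_adjoint herm) (simp add: cinner_vec_def sum_distrib_left mult_ac)
        then show ?thesis using \<open>y \<in> W\<close> that by (simp add: W_def)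
      qed
      then show ?thesis by (simp add: W_def)
    qed
    moreover have "inner (T *v a) b = inner a (T *v b)" for a b
      by (metis Re_cinner_vec cinner_vec_adjoint herm)
    ultimately obtain v l where v: "v \<in> W" "norm v = 1" "T *v v = l *\<^sub>R v"
      using self_adjoint_eigenvector[of "(*v) T" W x, OF matrix_vector_mul_linear] x(1) \<open>x \<in> W\<close>
      by (metis image_subsetI)
    have "T *v v = complex_of_real l *s v"
      using v(3) by (simp add: vec_eq_iff scaleR_conv_of_real[where 'a=complex])
    moreover have "cinner_vec v v = 1" using v by (simp add: cinner_vec_self)
    moreover have "cinner_vec (u i) v = 0" "cinner_vec v (u i) = 0" if "i \<in> I" for i
      using v that by (auto simp: W_def cinner_vec_commute[of v])
    ultimately show ?case using u insert.hyps
      by (intro exI[of _ "u(k := v)"] exI[of _ "d(k := l)"]) auto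
  qed auto
  from this[OF finite[of UNIV]] obtain u d where ud: "\<forall>i\<in>(UNIV :: 'n set). T *v u i = complex_of_real (d i) *s u i \<and>
      (\<forall>j\<in>UNIV. cinner_vec (u i) (u j) = (if i = j then 1 else 0))"
    by blast
  then have u: "\<And>i::'n. T *v u i = complex_of_real (d i) *s u i"
    "\<And>i j. cinner_vec (u i) (u j) = (if i = j then 1 else 0)"
    by auto
  define U :: "complex^'n^'n" where "U = (\<chi> i j. u j $ i)"
  have 1: "conj_transpose U ** U = mat 1"
    using u(2) by (simp add: vec_eq_iff matrix_matrix_mult_def U_def cinner_vec_def mat_def)
  then have 2: "U ** conj_transpose U = mat 1"
    using matrix_left_right_inverse by blast
  have "T ** U = U ** diag_mat d"
    using u(1) by (simp add: vec_eq_iff mult_diag_mat_nth) (simp add: U_def matrix_matrix_mult_def matrix_vector_mult_def mult.commute)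
  then have "T = U ** diag_mat d ** conj_transpose U"
    by (metis 2 matrix_mul_assoc matrix_mul_rid)
  then have "spectral_decomp U d T"
    using 1 2 by (simp add: spectral_decomp_def unitary_mat_def)
  then show ?thesis using that by blast
qed

section \<open>Convexity of powers\<close>

text \<open>The missing mass \<open>1 - sum w S\<close> is placed at the point 0, where it costs
  nothing because \<open>f 0 = 0\<close>.\<close>

lemma convex_on_sub_jensen:
  fixes f :: "real \<Rightarrow> real"
  assumes f: "convex_on {0..} f" "f 0 = 0" and "finite S"
    and w: "\<And>i. i \<in> S \<Longrightarrow> 0 \<le> w i" "sum w S \<le> 1" and x: "\<And>i. i \<in> S \<Longrightarrow> 0 \<le> x i"
  shows "f (\<Sum>i\<in>S. w i * x i) \<le> (\<Sum>i\<in>S. w i * f (x i))"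
proof (cases "sum w S = 0")
  case True
  then have "\<forall>i\<in>S. w i = 0" using w(1) \<open>finite S\<close> by (simp add: sum_nonneg_eq_0_iff)
  then show ?thesis by (simp add: f)
next
  case False
  define c where "c = sum w S"
  have c: "0 < c" "c \<le> 1" using False w by (auto simp: c_def sum_nonneg order_less_le)
  have "S \<noteq> {}" using False by auto
  define y where "y = (\<Sum>i\<in>S. (w i / c) *\<^sub>R x i)"
  have "0 \<le> y" unfolding y_def using w x c by (intro sum_nonneg) auto
  have "(\<Sum>i\<in>S. w i / c) = 1" using False by (simp add: c_def flip: sum_divide_distrib)
  then have J: "f y \<le> (\<Sum>i\<in>S. w i / c * f (x i))"
    unfolding y_def using w x c \<open>S \<noteq> {}\<close> \<open>finite S\<close> f by (intro convex_on_sum[where C = "{0..}"]) auto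
  have "f ((1 - c) *\<^sub>R 0 + c *\<^sub>R y) \<le> (1 - c) * f 0 + c * f y"
    using c \<open>0 \<le> y\<close> f by (intro convex_onD[where A = "{0..}"]) auto
  then have "f (c * y) \<le> c * f y" by (simp add: f)
  also have "\<dots> \<le> c * (\<Sum>i\<in>S. w i / c * f (x i))" using J c by simp
  also have "\<dots> = (\<Sum>i\<in>S. w i * f (x i))" using c by (simp add: sum_distrib_left)
  also have "c * y = (\<Sum>i\<in>S. w i * x i)" using c by (simp add: y_def sum_distrib_left)
  finally show ?thesis .
qed

text \<open>Young's inequality extended to the boundary: \<open>0 powr r\<close> is 0 for every
  exponent, even 0, so the left-hand side vanishes as soon as \<open>x\<close> or \<open>t\<close>
  does.\<close>

lemma powr_mult_powr_le:
  fixes x t :: real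
  assumes "0 < r" "r \<le> 1" "0 \<le> x" "0 \<le> t"
  shows "x powr r * t powr (1 - r) \<le> r * x + (1 - r) * t"
proof (cases "x = 0 \<or> t = 0")
  case True
  then show ?thesis using assms by auto
next
  case False
  then show ?thesis using assms by (intro Youngs_inequality_0) auto
qed

text \<open>Young's inequality bounds \<open>z * t powr (q - 1)\<close> for \<open>z = x\<close> and
  \<open>z = y\<close>, with \<open>t\<close> their convex combination. Averaging gives
  \<open>t powr q\<close> on the left, and the common part \<open>(1 - 1 / q) * t powr q\<close>
  cancels.\<close>

lemma convex_on_powr_atLeast:
  assumes "1 \<le> q"
  shows "convex_on {0..} (\<lambda>x::real. x powr q)"
proof (rule convex_onI)
  fix u x y :: real
  assume u: "0 < u" "u < 1" and xy: "x \<in> {0..}" "y \<in> {0..}"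
  define t where "t = (1 - u) * x + u * y"
  have t: "0 \<le> t" using u xy by (simp add: t_def)
  have Y: "z * t powr (q - 1) \<le> 1 / q * z powr q + (1 - 1 / q) * t powr q" if "0 \<le> z" for z
  proof -
    have "(z powr q) powr (1 / q) * (t powr q) powr (1 - 1 / q) \<le> 1 / q * z powr q + (1 - 1 / q) * t powr q"
      using assms by (intro powr_mult_powr_le) auto
    moreover have "q * (1 - 1 / q) = q - 1" using assms by (simp add: field_simps)
    then have "(z powr q) powr (1 / q) = z" "(t powr q) powr (1 - 1 / q) = t powr (q - 1)"
      using assms that by (simp_all add: powr_powr)
    ultimately show ?thesis by simp
  qed
  have "t powr q = t * t powr (q - 1)"
    using t by (simp add: powr_mult_base)
  also have "\<dots> = (1 - u) * (x * t powr (q - 1)) + u * (y * t powr (q - 1))"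
    by (simp add: t_def algebra_simps)
  also have "\<dots> \<le> (1 - u) * (1 / q * x powr q + (1 - 1 / q) * t powr q) + u * (1 / q * y powr q + (1 - 1 / q) * t powr q)"
    using u xy by (intro add_mono mult_left_mono Y) auto
  also have "\<dots> = 1 / q * ((1 - u) * x powr q + u * y powr q) + (1 - 1 / q) * t powr q"
    using assms by (simp add: field_simps)
  finally have "1 / q * t powr q \<le> 1 / q * ((1 - u) * x powr q + u * y powr q)"
    by (simp add: algebra_simps)
  then have "t powr q \<le> (1 - u) * x powr q + u * y powr q"
    using assms by (simp add: divide_le_cancel)
  then show "((1 - u) *\<^sub>R x + u *\<^sub>R y) powr q \<le> (1 - u) * x powr q + u * y powr q"
    by (simp add: t_def)
qed simp

text \<open>Concavity of the power: averaging
  \<open>x powr q * t powr (1 - q) \<le> q * x + (1 - q) * t\<close> over the two points gives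
  \<open>t\<close> on the right, and \<open>t powr (1 - q)\<close> is divided out. This requires the
  case \<open>t = 0\<close> to be treated apart.\<close>

lemma convex_on_minus_powr_atLeast:
  assumes "0 < q" "q \<le> 1"
  shows "convex_on {0..} (\<lambda>x::real. - (x powr q))"
proof (rule convex_onI)
  fix u x y :: real
  assume u: "0 < u" "u < 1" and xy: "x \<in> {0..}" "y \<in> {0..}"
  define t where "t = (1 - u) * x + u * y"
  have t: "0 \<le> t" using u xy by (simp add: t_def)
  have "(1 - u) * x powr q + u * y powr q \<le> t powr q"
  proof (cases "t = 0")
    case True
    then have "(1 - u) * x = 0" "u * y = 0" unfolding t_def using u xy
      by (auto simp: add_nonneg_eq_0_iff)
    then show ?thesis using u by simp
  next
    case False
    have "((1 - u) * x powr q + u * y powr q) * t powr (1 - q)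
        = (1 - u) * (x powr q * t powr (1 - q)) + u * (y powr q * t powr (1 - q))"
      by (simp add: algebra_simps)
    also have "\<dots> \<le> (1 - u) * (q * x + (1 - q) * t) + u * (q * y + (1 - q) * t)"
      using u xy t assms by (intro add_mono mult_left_mono powr_mult_powr_le) auto
    also have "\<dots> = t" by (simp add: t_def algebra_simps)
    also have "\<dots> = t powr q * t powr (1 - q)" using t False by (simp flip: powr_add)
    finally show ?thesis using t False by simp
  qed
  then show "- (((1 - u) *\<^sub>R x + u *\<^sub>R y) powr q) \<le> (1 - u) * - (x powr q) + u * - (y powr q)"
    by (simp add: t_def)
qed simp

section \<open>Schatten norms through eigenvalues\<close>

lemma spectral_decomp_mult_left:
  assumes "spectral_decomp U d T" "unitary_mat V"
  shows "spectral_decomp (V ** U) d (V ** T ** conj_transpose V)"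
  using assms by (simp add: spectral_decomp_def unitary_mat_mult conj_transpose_mult matrix_mul_assoc)

lemma spectral_decomp_hermitian: "spectral_decomp U d T \<Longrightarrow> conj_transpose T = T"
  by (auto simp: spectral_decomp_def conj_transpose_mult matrix_mul_assoc)

lemma spectral_decomp_square:
  assumes "spectral_decomp U d T"
  shows "spectral_decomp U (\<lambda>i. (d i)\<^sup>2) (T ** T)"
proof -
  have "T ** T = U ** diag_mat d ** (conj_transpose U ** U) ** diag_mat d ** conj_transpose U"
    using assms by (simp add: spectral_decomp_def matrix_mul_assoc)
  also have "\<dots> = U ** (diag_mat d ** diag_mat d) ** conj_transpose U"
    using assms by (simp add: spectral_decomp_def unitary_matD matrix_mul_assoc)
  finally show ?thesis using assms by (simp add: spectral_decomp_def diag_mat_mult power2_eq_square)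
qed

text \<open>The functional calculus is well defined: the change of basis \<open>X\<close>
  intertwines the two diagonals, so \<open>X $ i $ j\<close> is 0 unless \<open>e i = d j\<close>.
  Hence \<open>X\<close> also intertwines their images under \<open>f\<close>.\<close>

lemma spectral_decomp_fun_unique:
  assumes U: "spectral_decomp U d P" and V: "spectral_decomp V e P"
  shows "U ** diag_mat (\<lambda>i. f (d i)) ** conj_transpose U = V ** diag_mat (\<lambda>i. f (e i)) ** conj_transpose V"
proof -
  note u = unitary_matD[of U] unitary_matD[of V]
  have uU: "unitary_mat U" "unitary_mat V" using assms by (auto simp: spectral_decomp_def)
  define X where "X = conj_transpose V ** U"
  have "P ** U = U ** diag_mat d"
    by (metis U spectral_decomp_def matrix_mul_assoc matrix_mul_rid unitary_matD(1))
  moreover have "conj_transpose V ** P = diag_mat e ** conj_transpose V"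
    by (metis V spectral_decomp_def matrix_mul_assoc matrix_mul_lid unitary_matD(1))
  ultimately have "diag_mat e ** X = X ** diag_mat d"
    unfolding X_def by (metis matrix_mul_assoc)
  then have "e i = d j \<or> X $ i $ j = 0" for i j
    by (simp add: vec_eq_iff diag_mat_mult_nth mult_diag_mat_nth mult.commute) metis
  then have X: "diag_mat (\<lambda>i. f (e i)) ** X = X ** diag_mat (\<lambda>i. f (d i))"
    by (simp add: vec_eq_iff diag_mat_mult_nth mult_diag_mat_nth mult.commute) metis
  have "U = V ** X" unfolding X_def using uU by (simp add: matrix_mul_assoc u)
  then have "U ** diag_mat (\<lambda>i. f (d i)) ** conj_transpose U = V ** (X ** diag_mat (\<lambda>i. f (d i))) ** conj_transpose U"
    by (simp add: matrix_mul_assoc)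
  also have "\<dots> = V ** diag_mat (\<lambda>i. f (e i)) ** (X ** conj_transpose U)"
    by (simp flip: X add: matrix_mul_assoc)
  also have "X ** conj_transpose U = conj_transpose V"
    unfolding X_def using uU by (metis matrix_mul_assoc matrix_mul_rid unitary_matD(2))
  finally show ?thesis .
qed

lemma psd_powr_eq:
  assumes P: "spectral_decomp U d P" and d: "\<And>i. 0 \<le> d i"
  shows "psd_powr P s = U ** diag_mat (\<lambda>i. d i powr s) ** conj_transpose U"
  unfolding psd_powr_def
proof (rule the_equality)
  show "\<exists>Ua da. unitary_mat Ua \<and> (\<forall>i. 0 \<le> da i) \<and> P = Ua ** diag_mat da ** conj_transpose Ua \<and>
      U ** diag_mat (\<lambda>i. d i powr s) ** conj_transpose U = Ua ** diag_mat (\<lambda>i. da i powr s) ** conj_transpose Ua"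
    using assms by (auto simp: spectral_decomp_def)
next
  fix Q
  assume "\<exists>U d. unitary_mat U \<and> (\<forall>i. 0 \<le> d i) \<and> P = U ** diag_mat d ** conj_transpose U \<and>
    Q = U ** diag_mat (\<lambda>i. d i powr s) ** conj_transpose U"
  then obtain V e where "spectral_decomp V e P" and Q: "Q = V ** diag_mat (\<lambda>i. e i powr s) ** conj_transpose V"
    unfolding spectral_decomp_def by blast
  from spectral_decomp_fun_unique[OF P this(1), of "\<lambda>x. x powr s"]
  show "Q = U ** diag_mat (\<lambda>i. d i powr s) ** conj_transpose U" by (simp add: Q)
qed

lemma trace_psd_powr:
  assumes P: "spectral_decomp U d P" and d: "\<And>i. 0 \<le> d i"
  shows "Re (trace (psd_powr P s)) = (\<Sum>i\<in>UNIV. d i powr s)"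
proof -
  have "trace (psd_powr P s) = trace (conj_transpose U ** U ** diag_mat (\<lambda>i. d i powr s))"
    unfolding psd_powr_eq[OF assms] by (metis trace_mul_sym matrix_mul_assoc)
  also have "\<dots> = trace (diag_mat (\<lambda>i. d i powr s))"
    using P by (simp add: spectral_decomp_def unitary_matD)
  finally show ?thesis by (simp add: trace_def diag_mat_nth)
qed

lemma power2_powr_half: "((x::real)\<^sup>2) powr (p / 2) = \<bar>x\<bar> powr p"
proof -
  have "x\<^sup>2 = \<bar>x\<bar> powr 2" by (simp add: powr_numeral)
  then show ?thesis unfolding \<open>x\<^sup>2 = \<bar>x\<bar> powr 2\<close> powr_powr by simp
qed

text \<open>\<open>T\<close> is Hermitian, so \<open>conj_transpose T ** T\<close> is the square of
  \<open>T\<close> and the singular values are the \<bar>d i\<bar>. Stating the p-th power removes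
  the outer root.\<close>

lemma schatten_norm_powr:
  assumes T: "spectral_decomp U d T" and "0 < p"
  shows "schatten_norm (ereal p) T powr p = (\<Sum>i\<in>UNIV. \<bar>d i\<bar> powr p)"
proof -
  have "schatten_norm (ereal p) T = (\<Sum>i\<in>UNIV. \<bar>d i\<bar> powr p) powr (1 / p)"
    using trace_psd_powr[OF spectral_decomp_square[OF T]] spectral_decomp_hermitian[OF T]
    by (simp add: schatten_norm_def power2_powr_half)
  then show ?thesis using \<open>0 < p\<close> by (simp add: powr_powr sum_nonneg)
qed

section \<open>Convex functions of eigenvalues\<close>

lemma cinner_vec_spectral_decomp:
  assumes "spectral_decomp U d T"
  shows "cinner_vec y (T *v y) = complex_of_real (\<Sum>i\<in>UNIV. d i * (cmod ((conj_transpose U *v y) $ i))\<^sup>2)"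
proof -
  let ?z = "conj_transpose U *v y"
  have "T *v y = U *v (diag_mat d *v ?z)"
    using assms by (simp add: spectral_decomp_def matrix_vector_mul_assoc matrix_mul_assoc)
  then have "cinner_vec y (T *v y) = cinner_vec ?z (diag_mat d *v ?z)"
    by (simp add: cinner_vec_adjoint)
  also have "diag_mat d *v ?z = (\<chi> i. complex_of_real (d i) * ?z $ i)"
    by (simp add: vec_eq_iff matrix_vector_mult_def diag_mat_nth if_distrib [of "\<lambda>x. x * _"] cong: if_cong)
  also have "cinner_vec ?z \<dots> = complex_of_real (\<Sum>i\<in>UNIV. d i * (cmod (?z $ i))\<^sup>2)"
    unfolding cinner_vec_def of_real_sum of_real_mult complex_norm_square
    by (intro sum.cong) (auto simp: mult_ac)
  finally show ?thesis .
qed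

text \<open>Together with the column version, this makes the squared moduli of a unitary matrix
  doubly stochastic; they serve as Jensen weights.\<close>

lemma unitary_mat_row_sum:
  assumes "unitary_mat G"
  shows "(\<Sum>k\<in>UNIV. (cmod (G $ i $ k))\<^sup>2) = 1"
proof -
  have "complex_of_real (\<Sum>k\<in>UNIV. (cmod (G $ i $ k))\<^sup>2) = (G ** conj_transpose G) $ i $ i"
    unfolding of_real_sum complex_norm_square by (simp add: matrix_matrix_mult_def)
  then have "complex_of_real (\<Sum>k\<in>UNIV. (cmod (G $ i $ k))\<^sup>2) = complex_of_real 1"
    using assms by (simp add: unitary_matD mat_def)
  then show ?thesis unfolding of_real_eq_iff .
qed

lemma unitary_mat_column_sum:
  assumes "unitary_mat G"
  shows "(\<Sum>i\<in>UNIV. (cmod (G $ i $ k))\<^sup>2) = 1"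
  using unitary_mat_row_sum[OF unitary_mat_conj_transpose[OF assms], of k] by simp

text \<open>With \<open>P = U diag(a) U\<^sup>*\<close>, \<open>S = W diag(s) W\<^sup>*\<close> and \<open>G = U\<^sup>* W\<close>, the assumption \<open>le\<close> says \<open>P \<le> S\<close>.
  The weights have total mass \<open>a\<^sub>i \<langle>u\<^sub>i, S\<^sup>-\<^sup>1 u\<^sub>i\<rangle> \<le> 1\<close>, and their mean of the \<open>s\<^sub>k\<close> is \<open>a\<^sub>i\<close>. Where
  \<open>s\<^sub>k = 0\<close> the quotient is \<open>0\<close>, which is the right value.\<close>
lemma convex_dominated_eigenvalue:
  fixes G :: "complex^'n^'n"
  assumes G: "unitary_mat G" and a: "\<And>i. 0 \<le> a i" and s: "\<And>k. 0 \<le> s k"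
    and le: "\<And>y. (\<Sum>i\<in>UNIV. a i * (cmod ((G *v y) $ i))\<^sup>2) \<le> (\<Sum>k\<in>UNIV. s k * (cmod (y $ k))\<^sup>2)"
    and f: "convex_on {0..} f" "f 0 = 0"
  shows "f (a i) \<le> (\<Sum>k\<in>UNIV. a i * (cmod (G $ i $ k))\<^sup>2 / s k * f (s k))"
proof -
  let ?g = "\<lambda>k. (cmod (G $ i $ k))\<^sup>2"
  have one: "a i * (cmod ((G *v y) $ i))\<^sup>2 \<le> (\<Sum>k\<in>UNIV. s k * (cmod (y $ k))\<^sup>2)" for y
    by (rule order_trans[OF member_le_sum[where f = "\<lambda>i. a i * (cmod ((G *v y) $ i))\<^sup>2"] le]) (auto simp: a)
  \<comment> \<open>Testing \<open>le\<close> on the k-th basis vector: a zero eigenvalue of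
    \<open>S\<close> leaves no room for \<open>P\<close> in that direction. This makes the
    convention for division by 0 harmless.\<close>
  have zero: "a i * ?g k = 0" if "s k = 0" for k
  proof -
    have "(G *v axis k 1) $ i = G $ i $ k"
      by (simp add: matrix_vector_mult_def axis_def if_distrib [of "\<lambda>x. _ * x"] cong: if_cong)
    moreover have "(\<Sum>l\<in>UNIV. s l * (cmod (axis k 1 $ l))\<^sup>2) = 0"
      using that by (intro sum.neutral) (auto simp: axis_def)
    ultimately have "a i * ?g k \<le> 0" using one[of "axis k 1"] by simp
    then show ?thesis using a[of i] by (auto simp: mult_le_0_iff)
  qed
  define t where "t = (\<Sum>k\<in>UNIV. ?g k / s k)"
  have t: "0 \<le> t" unfolding t_def by (intro sum_nonneg) (simp add: s)
  \<comment> \<open>The coordinates, in the eigenbasis of \<open>S\<close>, of the pseudo-inverse of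
    \<open>S\<close> applied to the i-th eigenvector of \<open>P\<close>. Testing on it turns
    \<open>P \<le> S\<close> into \<open>a i * t\<^sup>2 \<le> t\<close>.\<close>
  define y :: "complex^'n" where "y = (\<chi> k. cnj (G $ i $ k) / complex_of_real (s k))"
  have "(G *v y) $ i = complex_of_real t"
    unfolding t_def of_real_sum by (simp add: matrix_vector_mult_def y_def complex_norm_square del: of_real_power)
  moreover have "s k * (cmod (y $ k))\<^sup>2 = ?g k / s k" for k
    using s[of k] by (simp add: y_def norm_divide power_divide power2_eq_square)
  ultimately have "a i * t\<^sup>2 \<le> t" using one[of y] by (simp add: t_def[symmetric])
  then have "t * (a i * t) \<le> t * 1" by (simp add: power2_eq_square mult_ac)
  then have mass: "a i * t \<le> 1" using t
    by (cases "t = 0") (auto simp: mult_le_cancel_left)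
  have "a i = (\<Sum>k\<in>UNIV. a i * ?g k)"
    using unitary_mat_row_sum[OF G, of i] by (simp flip: sum_distrib_left)
  also have "\<dots> = (\<Sum>k\<in>UNIV. a i * ?g k / s k * s k)"
    using zero by (intro sum.cong) auto
  finally have "f (a i) = f (\<Sum>k\<in>UNIV. a i * ?g k / s k * s k)" by simp
  also have "\<dots> \<le> (\<Sum>k\<in>UNIV. a i * ?g k / s k * f (s k))"
    using mass by (intro convex_on_sub_jensen f) (auto simp: a s t_def sum_distrib_left)
  finally show ?thesis .
qed

text \<open>Superadditivity: \<open>P\<close> and \<open>Q\<close> are both dominated by the sum,
  and the weights that their eigenvalues place on \<open>s k\<close> add up to 1 whenever
  \<open>s k\<close> is nonzero. Midpoint: \<open>s k / 2\<close> is the mean of the k-th diagonal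
  entries of \<open>P\<close> and \<open>Q\<close> in the eigenbasis of the sum, and each entry is a
  convex combination of eigenvalues.\<close>

lemma convex_eigenvalues_add:
  fixes P Q :: "complex^'n^'n"
  assumes P: "spectral_decomp U a P" and Q: "spectral_decomp V b Q" and S: "spectral_decomp W s (P + Q)"
    and a: "\<And>i. 0 \<le> a i" and b: "\<And>i. 0 \<le> b i" and f: "convex_on {0..} f" "f 0 = 0"
  shows "(\<Sum>i\<in>UNIV. f (a i)) + (\<Sum>i\<in>UNIV. f (b i)) \<le> (\<Sum>i\<in>UNIV. f (s i))" (is ?superadditive)
    and "2 * (\<Sum>i\<in>UNIV. f (s i / 2)) \<le> (\<Sum>i\<in>UNIV. f (a i)) + (\<Sum>i\<in>UNIV. f (b i))" (is ?midpoint)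
proof -
  define G where "G = conj_transpose U ** W"
  define K where "K = conj_transpose V ** W"
  let ?g = "\<lambda>i k. (cmod (G $ i $ k))\<^sup>2" and ?k = "\<lambda>i k. (cmod (K $ i $ k))\<^sup>2"
  have uni: "unitary_mat G" "unitary_mat K" unfolding G_def K_def
    using P Q S by (auto simp: spectral_decomp_def unitary_mat_mult unitary_mat_conj_transpose)
  have form: "(\<Sum>i\<in>UNIV. a i * (cmod ((G *v y) $ i))\<^sup>2) + (\<Sum>i\<in>UNIV. b i * (cmod ((K *v y) $ i))\<^sup>2)
      = (\<Sum>k\<in>UNIV. s k * (cmod (y $ k))\<^sup>2)" for y
  proof -
    let ?y = "W *v y"
    have W: "conj_transpose W *v ?y = y"
      using S by (simp add: matrix_vector_mul_assoc spectral_decomp_def unitary_matD)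
    have "cinner_vec ?y ((P + Q) *v ?y) = cinner_vec ?y (P *v ?y) + cinner_vec ?y (Q *v ?y)"
      by (simp add: matrix_vector_mult_add_rdistrib cinner_vec_add_right)
    then show ?thesis
      unfolding cinner_vec_spectral_decomp[OF P] cinner_vec_spectral_decomp[OF Q] cinner_vec_spectral_decomp[OF S] W
      by (simp only: matrix_vector_mul_assoc G_def K_def flip: of_real_add) (simp only: of_real_eq_iff)
  qed
  have diag: "s k = (\<Sum>i\<in>UNIV. a i * ?g i k) + (\<Sum>i\<in>UNIV. b i * ?k i k)" for k
  proof -
    have "(T *v axis k 1) $ i = T $ i $ k" for i and T :: "complex^'n^'n"
      by (simp add: matrix_vector_mult_def axis_def if_distrib [of "\<lambda>x. _ * x"] cong: if_cong)
    moreover have "(\<Sum>l\<in>UNIV. s l * (cmod (axis k 1 $ l))\<^sup>2) = s k"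
      by (simp add: axis_def if_distrib [of "\<lambda>x. _ * (cmod x)\<^sup>2"] cong: if_cong)
    ultimately show ?thesis using form[of "axis k 1"] by simp
  qed
  have s: "0 \<le> s k" for k unfolding diag by (intro add_nonneg_nonneg sum_nonneg) (simp_all add: a b)
  have nonneg: "0 \<le> (\<Sum>i\<in>UNIV. a i * (cmod ((G *v y) $ i))\<^sup>2)" "0 \<le> (\<Sum>i\<in>UNIV. b i * (cmod ((K *v y) $ i))\<^sup>2)" for y
    by (auto intro!: sum_nonneg simp: a b)
  have fa: "f (a i) \<le> (\<Sum>k\<in>UNIV. a i * ?g i k / s k * f (s k))" for i
    using form nonneg by (intro convex_dominated_eigenvalue uni a s f) (smt (verit))
  have fb: "f (b i) \<le> (\<Sum>k\<in>UNIV. b i * ?k i k / s k * f (s k))" for i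
    using form nonneg by (intro convex_dominated_eigenvalue uni b s f) (smt (verit))
  have "(\<Sum>i\<in>UNIV. f (a i)) + (\<Sum>i\<in>UNIV. f (b i))
      \<le> (\<Sum>i\<in>UNIV. \<Sum>k\<in>UNIV. a i * ?g i k / s k * f (s k)) + (\<Sum>i\<in>UNIV. \<Sum>k\<in>UNIV. b i * ?k i k / s k * f (s k))"
    by (intro add_mono sum_mono fa fb)
  also have "\<dots> = (\<Sum>k\<in>UNIV. (\<Sum>i\<in>UNIV. a i * ?g i k / s k * f (s k)) + (\<Sum>i\<in>UNIV. b i * ?k i k / s k * f (s k)))"
    by (subst (1 2) sum.swap) (simp add: sum.distrib)
  also have "\<dots> = (\<Sum>k\<in>UNIV. s k / s k * f (s k))"
  proof (intro sum.cong refl)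
    fix k
    have "s k / s k * f (s k) = ((\<Sum>i\<in>UNIV. a i * ?g i k) + (\<Sum>i\<in>UNIV. b i * ?k i k)) / s k * f (s k)"
      using diag[of k] by simp
    then show "(\<Sum>i\<in>UNIV. a i * ?g i k / s k * f (s k)) + (\<Sum>i\<in>UNIV. b i * ?k i k / s k * f (s k)) = s k / s k * f (s k)"
      by (simp only: sum_distrib_right sum_divide_distrib add_divide_distrib distrib_right)
  qed
  \<comment> \<open>Where \<open>s k = 0\<close> the quotient \<open>s k / s k\<close> is 0 rather
    than 1, but then \<open>f (s k)\<close> is 0 as well.\<close>
  also have "\<dots> = (\<Sum>k\<in>UNIV. f (s k))"
    by (intro sum.cong refl) (auto simp: f)
  finally show ?superadditive .
  have mid: "f (s k / 2) \<le> ((\<Sum>i\<in>UNIV. ?g i k * f (a i)) + (\<Sum>i\<in>UNIV. ?k i k * f (b i))) / 2" for k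
  proof -
    let ?x = "\<Sum>i\<in>UNIV. ?g i k * a i" and ?y = "\<Sum>i\<in>UNIV. ?k i k * b i"
    have xy: "0 \<le> ?x" "0 \<le> ?y" by (auto intro!: sum_nonneg simp: a b)
    have s2: "s k / 2 = (1 - 1/2) *\<^sub>R ?x + (1/2) *\<^sub>R ?y" by (simp add: diag mult.commute field_simps)
    have "f (s k / 2) \<le> (1 - 1/2) * f ?x + 1/2 * f ?y"
      unfolding s2 using xy by (intro convex_onD[OF f(1)]) auto
    moreover have "f ?x \<le> (\<Sum>i\<in>UNIV. ?g i k * f (a i))"
      by (intro convex_on_sub_jensen f) (auto simp: a unitary_mat_column_sum uni)
    moreover have "f ?y \<le> (\<Sum>i\<in>UNIV. ?k i k * f (b i))"
      by (intro convex_on_sub_jensen f) (auto simp: b unitary_mat_column_sum uni)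
    ultimately show ?thesis by simp
  qed
  have "2 * (\<Sum>k\<in>UNIV. f (s k / 2)) \<le> 2 * (\<Sum>k\<in>UNIV. ((\<Sum>i\<in>UNIV. ?g i k * f (a i)) + (\<Sum>i\<in>UNIV. ?k i k * f (b i))) / 2)"
    by (intro mult_left_mono sum_mono mid) simp
  also have "\<dots> = (\<Sum>k\<in>UNIV. \<Sum>i\<in>UNIV. ?g i k * f (a i)) + (\<Sum>k\<in>UNIV. \<Sum>i\<in>UNIV. ?k i k * f (b i))"
    by (simp add: sum.distrib flip: sum_divide_distrib)
  also have "\<dots> = (\<Sum>i\<in>UNIV. (\<Sum>k\<in>UNIV. ?g i k) * f (a i)) + (\<Sum>i\<in>UNIV. (\<Sum>k\<in>UNIV. ?k i k) * f (b i))"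
    by (subst (1 2) sum.swap) (simp add: sum_distrib_right)
  finally show ?midpoint by (simp add: unitary_mat_row_sum uni)
qed

section \<open>Clarkson-McCarthy inequalities for Hermitian matrices\<close>

lemma conj_transpose_add: "conj_transpose (A + B) = conj_transpose A + conj_transpose B"
  by (simp add: vec_eq_iff)

lemma conj_transpose_diff: "conj_transpose (A - B) = conj_transpose A - conj_transpose B"
  by (simp add: vec_eq_iff)

lemma spectral_decomp_scale:
  assumes "spectral_decomp U d T"
  shows "spectral_decomp U (\<lambda>i. c * d i) (scale_mat (complex_of_real c) T)"
proof -
  have left: "scale_mat (complex_of_real c) (X ** Y) = scale_mat (complex_of_real c) X ** Y"
    and right: "scale_mat (complex_of_real c) (X ** Y) = X ** scale_mat (complex_of_real c) Y" for X Y :: "complex^'n^'n"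
    by (simp_all add: vec_eq_iff matrix_matrix_mult_def sum_distrib_left mult_ac)
  have diag: "scale_mat (complex_of_real c) (diag_mat d) = diag_mat (\<lambda>i. c * d i)"
    by (simp add: vec_eq_iff diag_mat_nth)
  have "scale_mat (complex_of_real c) (U ** diag_mat d ** conj_transpose U) = U ** diag_mat (\<lambda>i. c * d i) ** conj_transpose U"
    unfolding left[of "U ** diag_mat d"] right[of U] diag ..
  then show ?thesis using assms by (simp add: spectral_decomp_def)
qed

text \<open>The first two bounds concern the squares of \<open>A + B\<close> and
  \<open>A - B\<close>, the last two those of \<open>A\<close> and \<open>B\<close>. By the
  parallelogram identity one diagonalisation of \<open>A ** A + B ** B\<close> serves both pairs,
  with eigenvalues doubled for the first.\<close>

lemma convex_eigenvalues_parallelogram: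
  fixes A B :: "complex^'n^'n"
  assumes A: "spectral_decomp U1 a A" and B: "spectral_decomp U2 b B"
    and plus: "spectral_decomp U3 c (A + B)" and minus: "spectral_decomp U4 d (A - B)"
    and W: "spectral_decomp W s (A ** A + B ** B)"
    and f: "convex_on {0..} f" "f 0 = 0"
  shows "(\<Sum>i\<in>UNIV. f ((c i)\<^sup>2)) + (\<Sum>i\<in>UNIV. f ((d i)\<^sup>2)) \<le> (\<Sum>i\<in>UNIV. f (2 * s i))"
    and "2 * (\<Sum>i\<in>UNIV. f (s i)) \<le> (\<Sum>i\<in>UNIV. f ((c i)\<^sup>2)) + (\<Sum>i\<in>UNIV. f ((d i)\<^sup>2))"
    and "(\<Sum>i\<in>UNIV. f ((a i)\<^sup>2)) + (\<Sum>i\<in>UNIV. f ((b i)\<^sup>2)) \<le> (\<Sum>i\<in>UNIV. f (s i))"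
    and "2 * (\<Sum>i\<in>UNIV. f (s i / 2)) \<le> (\<Sum>i\<in>UNIV. f ((a i)\<^sup>2)) + (\<Sum>i\<in>UNIV. f ((b i)\<^sup>2))"
proof -
  have "(A + B) ** (A + B) + (A - B) ** (A - B) = scale_mat (complex_of_real 2) (A ** A + B ** B)"
    by (simp add: vec_eq_iff matrix_matrix_mult_def algebra_simps sum.distrib sum_subtractf)
  then have S: "spectral_decomp W (\<lambda>i. 2 * s i) ((A + B) ** (A + B) + (A - B) ** (A - B))"
    using spectral_decomp_scale[OF W, of 2] by simp
  note square = spectral_decomp_square
  show "(\<Sum>i\<in>UNIV. f ((c i)\<^sup>2)) + (\<Sum>i\<in>UNIV. f ((d i)\<^sup>2)) \<le> (\<Sum>i\<in>UNIV. f (2 * s i))"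
    by (rule convex_eigenvalues_add(1)[OF square[OF plus] square[OF minus] S]) (auto simp: f)
  show "2 * (\<Sum>i\<in>UNIV. f (s i)) \<le> (\<Sum>i\<in>UNIV. f ((c i)\<^sup>2)) + (\<Sum>i\<in>UNIV. f ((d i)\<^sup>2))"
    using convex_eigenvalues_add(2)[OF square[OF plus] square[OF minus] S _ _ f] by simp
  show "(\<Sum>i\<in>UNIV. f ((a i)\<^sup>2)) + (\<Sum>i\<in>UNIV. f ((b i)\<^sup>2)) \<le> (\<Sum>i\<in>UNIV. f (s i))"
    by (rule convex_eigenvalues_add(1)[OF square[OF A] square[OF B] W]) (auto simp: f)
  show "2 * (\<Sum>i\<in>UNIV. f (s i / 2)) \<le> (\<Sum>i\<in>UNIV. f ((a i)\<^sup>2)) + (\<Sum>i\<in>UNIV. f ((b i)\<^sup>2))"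
    by (rule convex_eigenvalues_add(2)[OF square[OF A] square[OF B] W]) (auto simp: f)
qed

text \<open>For \<open>2 \<le> p\<close>, superadditivity for the squares of \<open>A + B\<close>
  and \<open>A - B\<close> is followed by the midpoint bound for those of \<open>A\<close> and
  \<open>B\<close>. For \<open>p \<le> 2\<close> the power is concave: signs flip, and the two facts
  exchange their roles.\<close>

theorem clarkson_schatten_hermitian:
  fixes A B :: "complex^'n^'n"
  assumes A: "conj_transpose A = A" and B: "conj_transpose B = B"
  shows "2 \<le> p \<Longrightarrow> schatten_norm (ereal p) (A + B) powr p + schatten_norm (ereal p) (A - B) powr p
      \<le> 2 powr (p - 1) * (schatten_norm (ereal p) A powr p + schatten_norm (ereal p) B powr p)"
    and "0 < p \<Longrightarrow> p \<le> 2 \<Longrightarrow> schatten_norm (ereal p) (A + B) powr p + schatten_norm (ereal p) (A - B) powr p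
      \<le> 2 * (schatten_norm (ereal p) A powr p + schatten_norm (ereal p) B powr p)"
proof -
  obtain U1 a where a: "spectral_decomp U1 a A" using A by (rule hermitian_spectral_decomp)
  obtain U2 b where b: "spectral_decomp U2 b B" using B by (rule hermitian_spectral_decomp)
  obtain U3 c where c: "spectral_decomp U3 c (A + B)"
    by (rule hermitian_spectral_decomp[of "A + B"]) (simp add: conj_transpose_add A B)
  obtain U4 d where d: "spectral_decomp U4 d (A - B)"
    by (rule hermitian_spectral_decomp[of "A - B"]) (simp add: conj_transpose_diff A B)
  obtain W s where s: "spectral_decomp W s (A ** A + B ** B)"
    by (rule hermitian_spectral_decomp[of "A ** A + B ** B"]) (simp add: conj_transpose_add conj_transpose_mult A B)
  note ineq = convex_eigenvalues_parallelogram[OF a b c d s]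
  {
    assume p: "2 \<le> p"
    have f: "convex_on {0..} (\<lambda>x. x powr (p / 2))" using p by (intro convex_on_powr_atLeast) simp
    \<comment> \<open>Links the argument \<open>2 * s i\<close> of the superadditive bound to the
      argument \<open>s i / 2\<close> of the midpoint bound: they differ by the factor 4, and
      \<open>4 powr (p / 2)\<close> is \<open>2 powr p\<close>.\<close>
    have four: "(2 * x) powr (p / 2) = 2 powr p * (x / 2) powr (p / 2)" for x :: real
    proof -
      have "(2 * x) powr (p / 2) = (2\<^sup>2 * (x / 2)) powr (p / 2)" by simp
      also have "\<dots> = (2\<^sup>2) powr (p / 2) * (x / 2) powr (p / 2)" by (rule powr_mult)
      finally show ?thesis unfolding power2_powr_half by simp
    qed
    have "(\<Sum>i\<in>UNIV. \<bar>c i\<bar> powr p) + (\<Sum>i\<in>UNIV. \<bar>d i\<bar> powr p) \<le> (\<Sum>i\<in>UNIV. (2 * s i) powr (p / 2))"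
      using ineq(1)[OF f] by (simp add: power2_powr_half)
    also have "\<dots> = 2 powr (p - 1) * (2 * (\<Sum>i\<in>UNIV. (s i / 2) powr (p / 2)))"
      unfolding four by (simp add: powr_diff sum_distrib_left)
    also have "\<dots> \<le> 2 powr (p - 1) * ((\<Sum>i\<in>UNIV. \<bar>a i\<bar> powr p) + (\<Sum>i\<in>UNIV. \<bar>b i\<bar> powr p))"
      using ineq(4)[OF f] by (intro mult_left_mono) (simp_all add: power2_powr_half)
    finally show "schatten_norm (ereal p) (A + B) powr p + schatten_norm (ereal p) (A - B) powr p
      \<le> 2 powr (p - 1) * (schatten_norm (ereal p) A powr p + schatten_norm (ereal p) B powr p)"
      using p by (simp add: schatten_norm_powr[OF a] schatten_norm_powr[OF b] schatten_norm_powr[OF c] schatten_norm_powr[OF d])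
  next
    assume p: "0 < p" "p \<le> 2"
    have f: "convex_on {0..} (\<lambda>x. - (x powr (p / 2)))" using p by (intro convex_on_minus_powr_atLeast) auto
    have "(\<Sum>i\<in>UNIV. \<bar>c i\<bar> powr p) + (\<Sum>i\<in>UNIV. \<bar>d i\<bar> powr p) \<le> 2 * (\<Sum>i\<in>UNIV. (s i) powr (p / 2))"
      using ineq(2)[OF f] by (simp add: power2_powr_half sum_negf)
    also have "\<dots> \<le> 2 * ((\<Sum>i\<in>UNIV. \<bar>a i\<bar> powr p) + (\<Sum>i\<in>UNIV. \<bar>b i\<bar> powr p))"
      using ineq(3)[OF f] by (simp add: power2_powr_half sum_negf)
    finally show "schatten_norm (ereal p) (A + B) powr p + schatten_norm (ereal p) (A - B) powr p
      \<le> 2 * (schatten_norm (ereal p) A powr p + schatten_norm (ereal p) B powr p)"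
      using p by (simp add: schatten_norm_powr[OF a] schatten_norm_powr[OF b] schatten_norm_powr[OF c] schatten_norm_powr[OF d])
  }
qed

lemma schatten_norm_unitary_conj:
  assumes "conj_transpose T = T" "unitary_mat V" "0 < p"
  shows "schatten_norm (ereal p) (V ** T ** conj_transpose V) powr p = schatten_norm (ereal p) T powr p"
proof -
  obtain U d where U: "spectral_decomp U d T" using assms(1) by (rule hermitian_spectral_decomp)
  show ?thesis
    by (simp add: schatten_norm_powr[OF U \<open>0 < p\<close>]
        schatten_norm_powr[OF spectral_decomp_mult_left[OF U assms(2)] \<open>0 < p\<close>])
qed

lemma schatten_norm_scale:
  assumes "conj_transpose T = T" "0 < p"
  shows "schatten_norm (ereal p) (scale_mat (complex_of_real c) T) powr p = \<bar>c\<bar> powr p * schatten_norm (ereal p) T powr p"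
proof -
  obtain U d where U: "spectral_decomp U d T" using assms(1) by (rule hermitian_spectral_decomp)
  show ?thesis
    by (simp add: schatten_norm_powr[OF U \<open>0 < p\<close>] schatten_norm_powr[OF spectral_decomp_scale[OF U] \<open>0 < p\<close>]
        abs_mult powr_mult sum_distrib_left)
qed

section \<open>Block matrices\<close>

lemma sum_UNIV_sum: "(\<Sum>x\<in>UNIV. f x) = (\<Sum>i\<in>UNIV. f (Inl i)) + (\<Sum>i\<in>UNIV. f (Inr i))"
  for f :: "'a::finite + 'b::finite \<Rightarrow> 'c::comm_monoid_add"
  by (simp add: sum.Plus flip: UNIV_Plus_UNIV)

lemma block_mat_nth [simp]:
  "block_mat A B C D $ Inl i $ Inl j = A $ i $ j" "block_mat A B C D $ Inl i $ Inr j = B $ i $ j"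
  "block_mat A B C D $ Inr i $ Inl j = C $ i $ j" "block_mat A B C D $ Inr i $ Inr j = D $ i $ j"
  by (simp_all add: block_mat_def)

lemma block_mat_mult:
  "block_mat A B C D ** block_mat A' B' C' D' =
   block_mat (A ** A' + B ** C') (A ** B' + B ** D') (C ** A' + D ** C') (C ** B' + D ** D')"
  by (simp add: vec_eq_iff split_sum_all matrix_matrix_mult_def sum_UNIV_sum)

lemma conj_transpose_block_mat:
  "conj_transpose (block_mat A B C D) =
   block_mat (conj_transpose A) (conj_transpose C) (conj_transpose B) (conj_transpose D)"
  by (simp add: vec_eq_iff split_sum_all)

lemma block_mat_add:
  "block_mat A B C D + block_mat A' B' C' D' = block_mat (A + A') (B + B') (C + C') (D + D')"
  by (simp add: vec_eq_iff split_sum_all)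

lemma block_mat_one: "block_mat (mat 1) 0 0 (mat 1) = mat 1"
  by (simp add: vec_eq_iff split_sum_all mat_def)

lemma matrix_mult_zero_left [simp]: "0 ** A = 0"
  by (simp add: vec_eq_iff matrix_matrix_mult_def)

lemma matrix_mult_zero_right [simp]: "A ** 0 = 0"
  by (simp add: vec_eq_iff matrix_matrix_mult_def)

lemma matrix_mult_uminus [simp]: "- A ** B = - (A ** B)" "A ** - B = - (A ** B)" for A :: "'a::ring_1^'n^'m"
  by (simp_all add: vec_eq_iff matrix_matrix_mult_def sum_negf)

lemma conj_transpose_simps [simp]:
  "conj_transpose 0 = 0" "conj_transpose (mat 1) = mat 1" "conj_transpose (- A) = - conj_transpose A"
  by (auto simp: vec_eq_iff mat_def)

text \<open>The spectrum of the block matrix is the disjoint union \<open>case_sum a d\<close> of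
  the two spectra.\<close>

lemma schatten_norm_block_diag:
  assumes "conj_transpose A = A" "conj_transpose D = D" "0 < p"
  shows "schatten_norm (ereal p) (block_mat A 0 0 D) powr p = schatten_norm (ereal p) A powr p + schatten_norm (ereal p) D powr p"
proof -
  obtain U a where U: "spectral_decomp U a A" using assms(1) by (rule hermitian_spectral_decomp)
  obtain V d where V: "spectral_decomp V d D" using assms(2) by (rule hermitian_spectral_decomp)
  have "diag_mat (case_sum a d) = block_mat (diag_mat a) 0 0 (diag_mat d)"
    by (simp add: vec_eq_iff split_sum_all diag_mat_nth)
  then have "spectral_decomp (block_mat U 0 0 V) (case_sum a d) (block_mat A 0 0 D)"
    using U V by (simp add: spectral_decomp_def unitary_mat_def conj_transpose_block_mat block_mat_mult block_mat_one)
  from schatten_norm_powr[OF this \<open>0 < p\<close>] show ?thesis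
    by (simp add: sum_UNIV_sum schatten_norm_powr[OF U \<open>0 < p\<close>] schatten_norm_powr[OF V \<open>0 < p\<close>])
qed

lemma block_sign_conj:
  fixes A :: "complex^'n^'n"
  defines "J \<equiv> block_mat (mat 1) 0 0 (- mat 1) :: complex^('n + 'n)^('n + 'n)"
  shows "unitary_mat J" "J ** block_mat A B C D ** conj_transpose J = block_mat A (- B) (- C) D"
  by (simp_all add: J_def unitary_mat_def conj_transpose_block_mat block_mat_mult block_mat_one)

lemma block_swap_conj:
  fixes A :: "complex^'n^'n"
  defines "F \<equiv> block_mat 0 (mat 1) (mat 1) 0 :: complex^('n + 'n)^('n + 'n)"
  shows "unitary_mat F" "F ** block_mat A B C D ** conj_transpose F = block_mat D C B A"
  by (simp_all add: F_def unitary_mat_def conj_transpose_block_mat block_mat_mult block_mat_one)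

text \<open>The matrix under the supremum in \<open>gen_num_radius\<close>. It is Hermitian for
  every angle and real-linear in \<open>T\<close>, so the eigenvalue results apply to it.\<close>

definition rotated_re :: "real \<Rightarrow> complex^'n^'n \<Rightarrow> complex^'n^'n" where
  "rotated_re \<theta> T = re_part (scale_mat (exp (\<i> * of_real \<theta>)) T)"

lemma gen_num_radius_rotated_re: "gen_num_radius p T = (SUP \<theta>. schatten_norm p (rotated_re \<theta> T))"
  by (simp add: gen_num_radius_def rotated_re_def)

lemma rotated_re_nth:
  "rotated_re \<theta> T $ i $ j = (exp (\<i> * of_real \<theta>) * T $ i $ j + cnj (exp (\<i> * of_real \<theta>) * T $ j $ i)) / 2"
  by (simp add: rotated_re_def re_part_def)

lemma conj_transpose_rotated_re [simp]: "conj_transpose (rotated_re \<theta> T) = rotated_re \<theta> T"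
  by (simp add: vec_eq_iff rotated_re_nth add.commute)

lemma rotated_re_add: "rotated_re \<theta> (S + T) = rotated_re \<theta> S + rotated_re \<theta> T"
  by (simp add: vec_eq_iff rotated_re_nth field_simps)

lemma rotated_re_scale:
  "rotated_re \<theta> (scale_mat (complex_of_real c) T) = scale_mat (complex_of_real c) (rotated_re \<theta> T)"
  by (simp add: vec_eq_iff rotated_re_nth field_simps)

lemma rotated_re_block_diag: "rotated_re \<theta> (block_mat A 0 0 D) = block_mat (rotated_re \<theta> A) 0 0 (rotated_re \<theta> D)"
  by (simp add: vec_eq_iff split_sum_all rotated_re_nth)

text \<open>Only this shape matters later: an off-diagonal block and its adjoint, which trade places
  when \<open>B\<close> and \<open>C\<close> do.\<close>

lemma rotated_re_block_offdiag:
  obtains X where "rotated_re \<theta> (block_mat 0 B C 0) = block_mat 0 X (conj_transpose X) 0"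
    "rotated_re \<theta> (block_mat 0 C B 0) = block_mat 0 (conj_transpose X) X 0"
proof
  let ?X = "\<chi> i j. rotated_re \<theta> (block_mat 0 B C 0) $ Inl i $ Inr j"
  show "rotated_re \<theta> (block_mat 0 B C 0) = block_mat 0 ?X (conj_transpose ?X) 0"
    "rotated_re \<theta> (block_mat 0 C B 0) = block_mat 0 (conj_transpose ?X) ?X 0"
    by (simp_all add: vec_eq_iff split_sum_all rotated_re_nth add.commute)
qed

section \<open>Generalized numerical radius\<close>

lemma norm_vector_scalar_mult: "norm (c *s x) = cmod c * norm x" for x :: "complex^'n"
  by (simp add: norm_vec_def norm_mult L2_set_right_distrib)

lemma scale_mat_mult_vec: "scale_mat c T *v x = c *s (T *v x)"
  by (simp add: vec_eq_iff matrix_vector_mult_def sum_distrib_left mult.assoc)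

lemma norm_matrix_vector_le_onorm: "norm (T *v x) \<le> onorm ((*v) T) * norm x"
  for T :: "complex^'n^'m"
  by (intro onorm matrix_vector_mul_bounded_linear)

text \<open>A crude bound, but independent of the angle: it makes the suprema over all angles
  bounded above.\<close>

lemma onorm_rotated_re_le:
  "onorm ((*v) (rotated_re \<theta> T)) \<le> (onorm ((*v) T) + onorm ((*v) (conj_transpose T))) / 2"
proof (rule onorm_bound)
  fix x
  let ?e = "exp (\<i> * complex_of_real \<theta>)"
  have "rotated_re \<theta> T = scale_mat (1/2) (scale_mat ?e T + scale_mat (cnj ?e) (conj_transpose T))"
    by (simp add: vec_eq_iff rotated_re_nth)
  then have "rotated_re \<theta> T *v x = (1/2) *s (?e *s (T *v x) + cnj ?e *s (conj_transpose T *v x))"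
    by (simp add: scale_mat_mult_vec matrix_vector_mult_add_rdistrib)
  then have "norm (rotated_re \<theta> T *v x) = norm (?e *s (T *v x) + cnj ?e *s (conj_transpose T *v x)) / 2"
    by (simp only: norm_vector_scalar_mult) simp
  also have "\<dots> \<le> (norm (?e *s (T *v x)) + norm (cnj ?e *s (conj_transpose T *v x))) / 2"
    by (intro divide_right_mono norm_triangle_ineq) simp
  also have "\<dots> = (norm (T *v x) + norm (conj_transpose T *v x)) / 2"
    by (simp add: norm_vector_scalar_mult)
  also have "\<dots> \<le> (onorm ((*v) T) * norm x + onorm ((*v) (conj_transpose T)) * norm x) / 2"
    by (intro divide_right_mono add_mono norm_matrix_vector_le_onorm) simp
  finally show "norm (rotated_re \<theta> T *v x) \<le> (onorm ((*v) T) + onorm ((*v) (conj_transpose T))) / 2 * norm x"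
    by (simp add: algebra_simps add_divide_distrib)
qed (simp add: onorm_pos_le matrix_vector_mul_bounded_linear)

text \<open>The i-th column of \<open>U\<close> is a unit vector that \<open>T\<close> multiplies by
  \<open>d i\<close>.\<close>

lemma abs_eigenvalue_le_onorm:
  assumes "spectral_decomp U d T"
  shows "\<bar>d i\<bar> \<le> onorm ((*v) T)"
proof -
  let ?e = "axis i 1 :: complex^'a"
  have "T ** U = U ** diag_mat d"
    by (metis assms spectral_decomp_def matrix_mul_assoc matrix_mul_rid unitary_matD(1))
  then have "T *v (U *v ?e) = U *v (diag_mat d *v ?e)"
    by (simp add: matrix_vector_mul_assoc)
  also have "diag_mat d *v ?e = d i *\<^sub>R ?e"
    by (simp add: vec_eq_iff matrix_vector_mult_def diag_mat_nth axis_def scaleR_conv_of_real[where 'a=complex]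
        if_distrib [of "\<lambda>x. _ * x"] cong: if_cong)
  finally have "norm (T *v (U *v ?e)) = \<bar>d i\<bar>"
    using assms by (simp add: norm_matrix_vector_isometry spectral_decomp_def unitary_matD)
  moreover have "norm (U *v ?e) = 1"
    using assms by (simp add: norm_matrix_vector_isometry spectral_decomp_def unitary_matD)
  ultimately show ?thesis using norm_matrix_vector_le_onorm[of T "U *v ?e"] by simp
qed

lemma schatten_norm_nonneg: "0 \<le> schatten_norm p T"
  by (simp add: schatten_norm_def onorm_pos_le matrix_vector_mul_bounded_linear)

lemma bdd_above_schatten_norm_rotated_re:
  fixes T :: "complex^'n^'n"
  assumes "0 < p"
  shows "bdd_above (range (\<lambda>\<theta>. schatten_norm (ereal p) (rotated_re \<theta> T)))"
proof (rule bdd_aboveI2)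
  fix \<theta>
  let ?c = "(onorm ((*v) T) + onorm ((*v) (conj_transpose T))) / 2"
  obtain U d where U: "spectral_decomp U d (rotated_re \<theta> T)"
    using conj_transpose_rotated_re by (rule hermitian_spectral_decomp)
  have "\<bar>d i\<bar> \<le> ?c" for i
    using abs_eigenvalue_le_onorm[OF U] onorm_rotated_re_le[of \<theta> T] order_trans by blast
  then have "(\<Sum>i\<in>UNIV. \<bar>d i\<bar> powr p) \<le> (\<Sum>i\<in>(UNIV :: 'n set). ?c powr p)"
    using assms by (intro sum_mono powr_mono2) auto
  then have "(schatten_norm (ereal p) (rotated_re \<theta> T) powr p) powr (1 / p) \<le> (\<Sum>i\<in>(UNIV :: 'n set). ?c powr p) powr (1 / p)"
    unfolding schatten_norm_powr[OF U assms] using assms by (intro powr_mono2) (auto simp: sum_nonneg)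
  then show "schatten_norm (ereal p) (rotated_re \<theta> T) \<le> (\<Sum>i\<in>(UNIV :: 'n set). ?c powr p) powr (1 / p)"
    using assms by (simp add: powr_powr schatten_norm_nonneg)
qed

lemma schatten_norm_rotated_re_le:
  assumes "0 < p"
  shows "schatten_norm (ereal p) (rotated_re \<theta> T) powr p \<le> gen_num_radius (ereal p) T powr p"
  unfolding gen_num_radius_rotated_re using assms
  by (intro powr_mono2 cSUP_upper bdd_above_schatten_norm_rotated_re) (auto simp: schatten_norm_nonneg)

lemma onorm_rotated_re_le_gen_num_radius:
  "onorm ((*v) (rotated_re \<theta> T)) \<le> gen_num_radius \<infinity> T"
  unfolding gen_num_radius_rotated_re schatten_norm_def
  by (auto intro!: cSUP_upper2[where x = \<theta>] bdd_aboveI2 onorm_rotated_re_le)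

text \<open>Taking p-th roots turns the hypothesis into a bound on the norms themselves, which
  passes to the supremum and is then raised back to the power \<open>p\<close>.\<close>

lemma gen_num_radius_powr_le:
  assumes "0 < p" and le: "\<And>\<theta>. schatten_norm (ereal p) (rotated_re \<theta> T) powr p \<le> C"
  shows "gen_num_radius (ereal p) T powr p \<le> C"
proof -
  have "0 \<le> C" using le[of 0] order_trans powr_ge_zero by blast
  have "schatten_norm (ereal p) (rotated_re \<theta> T) \<le> C powr (1 / p)" for \<theta>
  proof -
    have "(schatten_norm (ereal p) (rotated_re \<theta> T) powr p) powr (1 / p) \<le> C powr (1 / p)"
      using le assms(1) by (intro powr_mono2) auto
    then show ?thesis using assms(1) by (simp add: powr_powr schatten_norm_nonneg)
  qed
  then have "gen_num_radius (ereal p) T \<le> C powr (1 / p)"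
    unfolding gen_num_radius_rotated_re by (intro cSUP_least) auto
  moreover have "0 \<le> gen_num_radius (ereal p) T"
    unfolding gen_num_radius_rotated_re
    by (rule cSUP_upper2[where x = 0])
      (auto simp: bdd_above_schatten_norm_rotated_re[OF assms(1)] schatten_norm_nonneg)
  ultimately have "gen_num_radius (ereal p) T powr p \<le> (C powr (1 / p)) powr p"
    using assms(1) by (intro powr_mono2) auto
  then show ?thesis using assms(1) \<open>0 \<le> C\<close> by (simp add: powr_powr)
qed

section \<open>Diagonal and off-diagonal parts of a block matrix\<close>

lemma rotated_re_block_split:
  "rotated_re \<theta> (block_mat A B C D) = rotated_re \<theta> (block_mat A 0 0 D) + rotated_re \<theta> (block_mat 0 B C 0)"
  by (simp add: block_mat_add flip: rotated_re_add)

text \<open>Conjugation by \<open>?J\<close> fixes the diagonal blocks and negates the off-diagonal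
  ones, without changing the eigenvalues.\<close>

lemma schatten_norm_rotated_re_block_diff:
  assumes "0 < p"
  shows "schatten_norm (ereal p) (rotated_re \<theta> (block_mat A 0 0 D) - rotated_re \<theta> (block_mat 0 B C 0)) powr p
    = schatten_norm (ereal p) (rotated_re \<theta> (block_mat A B C D)) powr p"
proof -
  obtain X where X: "rotated_re \<theta> (block_mat 0 B C 0) = block_mat 0 X (conj_transpose X) 0"
    by (rule rotated_re_block_offdiag)
  let ?J = "block_mat (mat 1) 0 0 (- mat 1) :: complex^('a + 'a)^('a + 'a)"
  have "rotated_re \<theta> (block_mat A 0 0 D) - rotated_re \<theta> (block_mat 0 B C 0)
      = ?J ** rotated_re \<theta> (block_mat A B C D) ** conj_transpose ?J"
    unfolding rotated_re_block_split[of \<theta> A B] X rotated_re_block_diag block_mat_add block_sign_conj(2)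
    by (simp add: vec_eq_iff split_sum_all)
  then show ?thesis
    by (simp add: schatten_norm_unitary_conj[OF _ block_sign_conj(1) assms])
qed

text \<open>Conjugation by the flip of the two summands exchanges the off-diagonal blocks, so the
  entries (1,2) and (2,1) can share the off-diagonal part equally.\<close>

lemma schatten_norm_rotated_re_block_swap:
  assumes "0 < p"
  shows "schatten_norm (ereal p) (rotated_re \<theta> (block_mat 0 C B 0)) powr p
    = schatten_norm (ereal p) (rotated_re \<theta> (block_mat 0 B C 0)) powr p"
proof -
  obtain X where X: "rotated_re \<theta> (block_mat 0 B C 0) = block_mat 0 X (conj_transpose X) 0"
    "rotated_re \<theta> (block_mat 0 C B 0) = block_mat 0 (conj_transpose X) X 0"
    by (rule rotated_re_block_offdiag)
  then show ?thesis
    using schatten_norm_unitary_conj[OF conj_transpose_rotated_re block_swap_conj(1) assms, of \<theta> "block_mat 0 B C 0"]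
    by (simp add: block_swap_conj(2))
qed

text \<open>The two diagonal entries bound the block diagonal part, whose p-th power splits; each
  off-diagonal entry bounds half of the off-diagonal part.\<close>

lemma schatten_norm_diag_offdiag_le:
  fixes A :: "nat \<Rightarrow> nat \<Rightarrow> complex^'n^'n"
  assumes "0 < p"
  shows "schatten_norm (ereal p) (rotated_re \<theta> (block_mat (A 1 1) 0 0 (A 2 2))) powr p
      + schatten_norm (ereal p) (rotated_re \<theta> (block_mat 0 (A 1 2) (A 2 1) 0)) powr p
    \<le> (\<Sum>i\<in>{1,2}. \<Sum>j\<in>{1,2}. entry_radius (ereal p) A i j powr p)"
proof -
  have off: "schatten_norm (ereal p) (rotated_re \<theta> (block_mat 0 (A i j) (A j i) 0)) powr p / 2
      \<le> entry_radius (ereal p) A i j powr p" if "i \<noteq> j" for i j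
  proof -
    have "(2 powr (- 1 / p)) powr p = 1 / 2"
      unfolding powr_powr using assms by (simp add: powr_minus_divide)
    then have "schatten_norm (ereal p) (rotated_re \<theta> (block_mat 0 (A i j) (A j i) 0)) powr p / 2 =
      schatten_norm (ereal p) (rotated_re \<theta> (scale_mat (of_real (2 powr (- 1 / p))) (block_mat 0 (A i j) (A j i) 0))) powr p"
      unfolding rotated_re_scale schatten_norm_scale[OF conj_transpose_rotated_re assms] by simp
    also have "\<dots> \<le> entry_radius (ereal p) A i j powr p"
      using that assms by (simp add: entry_radius_def schatten_norm_rotated_re_le)
    finally show ?thesis .
  qed
  have "schatten_norm (ereal p) (rotated_re \<theta> (A i i)) powr p \<le> entry_radius (ereal p) A i i powr p" for i
    using assms by (simp add: entry_radius_def schatten_norm_rotated_re_le)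
  from this[of 1] this[of 2] off[of 1 2] off[of 2 1]
    schatten_norm_rotated_re_block_swap[OF assms, of \<theta> "A 2 1" "A 1 2"] show ?thesis
    by (simp add: rotated_re_block_diag schatten_norm_block_diag assms)
qed

section \<open>Operator norms of block diagonal matrices\<close>

lemma norm_vec_sum_type:
  "(norm x)\<^sup>2 = (norm (\<chi> i. x $ Inl i))\<^sup>2 + (norm (\<chi> i. x $ Inr i))\<^sup>2"
  for x :: "'c::real_normed_vector^('a::finite + 'b::finite)"
  by (simp add: norm_vec_def L2_set_def sum_nonneg sum_UNIV_sum)

text \<open>Each block acts on its own half of the vector, and the squared norms of the halves
  add.\<close>

lemma onorm_block_diag_le:
  fixes A D :: "complex^'n^'n"
  assumes A: "onorm ((*v) A) \<le> m" and D: "onorm ((*v) D) \<le> m"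
  shows "onorm ((*v) (block_mat A 0 0 D)) \<le> m"
proof (rule onorm_bound)
  show m: "0 \<le> m" using A onorm_pos_le[of "(*v) A"] matrix_vector_mul_bounded_linear[of A] by linarith
  fix x :: "complex^('n + 'n)"
  let ?l = "\<chi> i. x $ Inl i" and ?r = "\<chi> i. x $ Inr i"
  have "norm (A *v ?l) \<le> m * norm ?l" "norm (D *v ?r) \<le> m * norm ?r"
    using norm_matrix_vector_le_onorm[of A ?l] norm_matrix_vector_le_onorm[of D ?r] A D
    by (meson mult_right_mono norm_ge_zero order_trans)+
  then have "(norm (A *v ?l))\<^sup>2 + (norm (D *v ?r))\<^sup>2 \<le> (m * norm ?l)\<^sup>2 + (m * norm ?r)\<^sup>2"
    by (intro add_mono power_mono) auto
  moreover have "(\<chi> i. (block_mat A 0 0 D *v x) $ Inl i) = A *v ?l" "(\<chi> i. (block_mat A 0 0 D *v x) $ Inr i) = D *v ?r"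
    by (simp_all add: vec_eq_iff matrix_vector_mult_def sum_UNIV_sum)
  ultimately have "(norm (block_mat A 0 0 D *v x))\<^sup>2 \<le> (m * norm x)\<^sup>2"
    by (simp add: norm_vec_sum_type[of x] norm_vec_sum_type[of "block_mat A 0 0 D *v x"] power_mult_distrib distrib_left)
  then show "norm (block_mat A 0 0 D *v x) \<le> m * norm x"
    using m by (simp add: power2_le_iff_abs_le)
qed

text \<open>For finite \<open>p\<close> the constants are half of those in the Clarkson-McCarthy
  inequalities. At \<infinity> the triangle inequality is enough: the diagonal and the off-diagonal
  part each have operator norm at most the largest entry radius.\<close>

theorem theorem2p3:
  fixes A :: "nat \<Rightarrow> nat \<Rightarrow> complex^'n^'n"
  defines "M \<equiv> block_mat (A 1 1) (A 1 2) (A 2 1) (A 2 2)"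
  shows "(\<forall>p::real. 2 \<le> p \<longrightarrow>
            gen_num_radius (ereal p) M powr p
              \<le> 2 powr (p - 2) * (\<Sum>i\<in>{1,2}. \<Sum>j\<in>{1,2}. entry_radius (ereal p) A i j powr p))
       \<and> gen_num_radius \<infinity> M \<le> 2 * Max {entry_radius \<infinity> A i j | i j. i \<in> {1,2} \<and> j \<in> {1,2}}
       \<and> (\<forall>p::real. 1 \<le> p \<and> p \<le> 2 \<longrightarrow>
            gen_num_radius (ereal p) M powr p
              \<le> (\<Sum>i\<in>{1,2}. \<Sum>j\<in>{1,2}. entry_radius (ereal p) A i j powr p))"
proof (intro conjI allI impI)
  let ?D = "\<lambda>\<theta>. rotated_re \<theta> (block_mat (A 1 1) 0 0 (A 2 2))"
    and ?O = "\<lambda>\<theta>. rotated_re \<theta> (block_mat 0 (A 1 2) (A 2 1) 0)"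
  let ?S = "\<lambda>p. \<Sum>i\<in>{1,2}. \<Sum>j\<in>{1,2}. entry_radius (ereal p) A i j powr p"
  have split: "rotated_re \<theta> M = ?D \<theta> + ?O \<theta>" for \<theta>
    unfolding M_def by (rule rotated_re_block_split)
  \<comment> \<open>The norms of sum and difference coincide, so the left-hand side of
    Clarkson-McCarthy is twice the quantity to be bounded.\<close>
  have reflect: "schatten_norm (ereal p) (?D \<theta> + ?O \<theta>) powr p + schatten_norm (ereal p) (?D \<theta> - ?O \<theta>) powr p
      = 2 * schatten_norm (ereal p) (rotated_re \<theta> M) powr p" if "0 < p" for p \<theta>
    unfolding schatten_norm_rotated_re_block_diff[OF that] split[symmetric] by (simp add: M_def)
  show "gen_num_radius (ereal p) M powr p \<le> 2 powr (p - 2) * ?S p" if p: "2 \<le> p" for p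
  proof (rule gen_num_radius_powr_le)
    fix \<theta>
    have "2 * schatten_norm (ereal p) (rotated_re \<theta> M) powr p
        \<le> 2 powr (p - 1) * (schatten_norm (ereal p) (?D \<theta>) powr p + schatten_norm (ereal p) (?O \<theta>) powr p)"
      using clarkson_schatten_hermitian(1)[of "?D \<theta>" "?O \<theta>" p] reflect[of p \<theta>] p by simp
    also have "\<dots> \<le> 2 powr (p - 1) * ?S p"
      using p by (intro mult_left_mono schatten_norm_diag_offdiag_le) auto
    also have "\<dots> = 2 * (2 powr (p - 2) * ?S p)"
      by (simp add: powr_diff)
    finally show "schatten_norm (ereal p) (rotated_re \<theta> M) powr p \<le> 2 powr (p - 2) * ?S p" by simp
  qed (use p in simp)
  show "gen_num_radius (ereal p) M powr p \<le> ?S p" if p: "1 \<le> p \<and> p \<le> 2" for p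
  proof (rule gen_num_radius_powr_le)
    fix \<theta>
    have "2 * schatten_norm (ereal p) (rotated_re \<theta> M) powr p
        \<le> 2 * (schatten_norm (ereal p) (?D \<theta>) powr p + schatten_norm (ereal p) (?O \<theta>) powr p)"
      using clarkson_schatten_hermitian(2)[of "?D \<theta>" "?O \<theta>" p] reflect[of p \<theta>] p by simp
    also have "\<dots> \<le> 2 * ?S p"
      using p by (intro mult_left_mono schatten_norm_diag_offdiag_le) auto
    finally show "schatten_norm (ereal p) (rotated_re \<theta> M) powr p \<le> ?S p" by simp
  qed (use p in simp)
  define m where "m = Max {entry_radius \<infinity> A i j | i j. i \<in> {1,2} \<and> j \<in> {1,2}}"
  have m: "entry_radius \<infinity> A i j \<le> m" if "i \<in> {1,2}" "j \<in> {1,2}" for i j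
    unfolding m_def using that by (intro Max_ge finite_image_set2) auto
  have "onorm ((*v) (rotated_re \<theta> M)) \<le> 2 * m" for \<theta>
  proof -
    have "onorm ((*v) (rotated_re \<theta> (A i i))) \<le> m" if "i \<in> {1,2}" for i
      using m[OF that that] onorm_rotated_re_le_gen_num_radius[of \<theta> "A i i"] by (simp add: entry_radius_def)
    then have "onorm ((*v) (?D \<theta>)) \<le> m"
      unfolding rotated_re_block_diag by (intro onorm_block_diag_le) auto
    \<comment> \<open>At \<infinity> the scaling factor of the off-diagonal entries is 1:
      \<open>real_of_ereal \<infinity>\<close> is 0, division by 0 gives 0, and
      \<open>2 powr 0 = 1\<close>.\<close>
    moreover have "scale_mat 1 T = T" for T :: "complex^('n + 'n)^('n + 'n)"
      by (simp add: vec_eq_iff)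
    then have "onorm ((*v) (?O \<theta>)) \<le> m"
      using m[of 1 2] onorm_rotated_re_le_gen_num_radius[of \<theta> "block_mat 0 (A 1 2) (A 2 1) 0"]
      by (simp add: entry_radius_def)
    moreover have "onorm (\<lambda>x. ?D \<theta> *v x + ?O \<theta> *v x) \<le> onorm ((*v) (?D \<theta>)) + onorm ((*v) (?O \<theta>))"
      by (intro onorm_triangle matrix_vector_mul_bounded_linear)
    moreover have sum: "(*v) (rotated_re \<theta> M) = (\<lambda>x. ?D \<theta> *v x + ?O \<theta> *v x)"
      by (simp add: fun_eq_iff split matrix_vector_mult_add_rdistrib)
    ultimately show ?thesis unfolding sum by linarith
  qed
  then show "gen_num_radius \<infinity> M \<le> 2 * Max {entry_radius \<infinity> A i j | i j. i \<in> {1,2} \<and> j \<in> {1,2}}"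
    unfolding gen_num_radius_rotated_re m_def[symmetric] by (intro cSUP_least) (auto simp: schatten_norm_def)
qed

end
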